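(* Let $G$ be a finite group, let $a,b,c$ be non-identity elements of $G$ and let $A=\langle a\rangle$, $B=\langle b\rangle$, $C=\langle c\rangle$. Suppose that $abc=1$, that $|A\cap B|=|A\cap C|=|B\cap C|=1$, and that $G=\langle a,b,c\rangle$. Let $(T^{\circ},T^{\star})$ be the latin bitrade $$T^{\circ}=\{(gA,gB,gC)\mid g\in G\},\qquad T^{\star}=\{(gA,gB,ga^{-1}C)\mid g\in G\}.$$ Then $(T^{\circ},T^{\star})$ is $k$-homogeneous if and only if $|A|=|B|=|C|=k$.
   Context: Let $A_1,A_2,A_3$ be finite, non-empty, pairwise disjoint sets (of rows, columns and symbols/entries, respectively). A partial latin square is a subset $T\subseteq A_1\times A_2\times A_3$ such that (P1) if $(a_1,a_2,a_3),(b_1,b_2,b_3)\in T$ then either at most one of $a_1=b_1$, $a_2=b_2$, $a_3=b_3$ is true or all three are true; (P2) every $\alpha\in A_1\cup A_2\cup A_3$ occurs as a coordinate of some element of $T$. A latin bitrade is a pair $(T^{\circ},T^{\star})$ of partial latin squares $T^{\circ},T^{\star}\subset A_1\times A_2\times A_3$ such that (R1) $T^{\circ}\cap T^{\star}=\emptyset$; (R2) for all $(a_1,a_2,a_3)\in T^{\circ}$ and all $r\ne s$ in $\{1,2,3\}$ there is a unique $(b_1,b_2,b_3)\in T^{\star}$ with $a_r=b_r$ and $a_s=b_s$; (R3) the same as (R2) with $T^{\circ}$ and $T^{\star}$ interchanged. Under the hypotheses of the claim the given pair is a latin bitrade, with $A_1,A_2,A_3$ the sets of left cosets in $G$ of $A,B,C$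 respectively. A latin bitrade $(T^{\circ},T^{\star})$ is $k$-homogeneous if its latin trade $T^{\circ}$ is: each row and each column of $T^{\circ}$ contains precisely $k$ entries and each symbol occurs precisely $k$ times within $T^{\circ}$. *)

theory Defs
  imports "HOL-Algebra.Left_Coset" "HOL-Algebra.Generated_Groups"
begin

text \<open>
  Rows, columns and symbols live in one common type, so that the pairwise disjointness of the
  three index sets can be stated. Coordinates of a triple are numbered 1, 2, 3; the function is
  only meant to be used at these three arguments.
\<close>

definition coord :: "'x \<times> 'x \<times> 'x \<Rightarrow> nat \<Rightarrow> 'x" where
  "coord t r = (if r = 1 then fst t else if r = 2 then fst (snd t) else snd (snd t))"

definition partial_latin_square ::
    "'x set \<Rightarrow> 'x set \<Rightarrow> 'x set \<Rightarrow> ('x \<times> 'x \<times> 'x) set \<Rightarrow> bool" where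
  "partial_latin_square A1 A2 A3 T \<longleftrightarrow>
     finite A1 \<and> finite A2 \<and> finite A3 \<and>
     A1 \<noteq> {} \<and> A2 \<noteq> {} \<and> A3 \<noteq> {} \<and>
     A1 \<inter> A2 = {} \<and> A1 \<inter> A3 = {} \<and> A2 \<inter> A3 = {} \<and>
     T \<subseteq> A1 \<times> A2 \<times> A3 \<and>
     (\<forall>x\<in>T. \<forall>y\<in>T.
        (\<forall>r\<in>{1, 2, 3}. \<forall>s\<in>{1, 2, 3}.
            coord x r = coord y r \<and> coord x s = coord y s \<longrightarrow> r = s) \<or>
        (\<forall>r\<in>{1, 2, 3}. coord x r = coord y r)) \<and>
     (\<forall>\<alpha>\<in>A1 \<union> A2 \<union> A3. \<exists>t\<in>T. \<exists>r\<in>{1, 2, 3}. coord t r = \<alpha>)"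

definition latin_bitrade ::
    "'x set \<Rightarrow> 'x set \<Rightarrow> 'x set \<Rightarrow> ('x \<times> 'x \<times> 'x) set \<Rightarrow> ('x \<times> 'x \<times> 'x) set \<Rightarrow> bool" where
  "latin_bitrade A1 A2 A3 T T' \<longleftrightarrow>
     partial_latin_square A1 A2 A3 T \<and>
     partial_latin_square A1 A2 A3 T' \<and>
     T \<inter> T' = {} \<and>
     (\<forall>x\<in>T. \<forall>r\<in>{1, 2, 3}. \<forall>s\<in>{1, 2, 3}. r \<noteq> s \<longrightarrow>
        (\<exists>!y. y \<in> T' \<and> coord x r = coord y r \<and> coord x s = coord y s)) \<and>
     (\<forall>x\<in>T'. \<forall>r\<in>{1, 2, 3}. \<forall>s\<in>{1, 2, 3}. r \<noteq> s \<longrightarrow>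
        (\<exists>!y. y \<in> T \<and> coord x r = coord y r \<and> coord x s = coord y s))"

text \<open>
  The entries of a row (column) are its filled cells, that is, the triples having that row
  (column) as a coordinate.
\<close>

definition homogeneous_trade ::
    "nat \<Rightarrow> 'x set \<Rightarrow> 'x set \<Rightarrow> 'x set \<Rightarrow> ('x \<times> 'x \<times> 'x) set \<Rightarrow> bool" where
  "homogeneous_trade k A1 A2 A3 T \<longleftrightarrow>
     (\<forall>x\<in>A1. card {t \<in> T. coord t 1 = x} = k) \<and>
     (\<forall>y\<in>A2. card {t \<in> T. coord t 2 = y} = k) \<and>
     (\<forall>z\<in>A3. card {t \<in> T. coord t 3 = z} = k)"

definition homogeneous_bitrade ::
    "nat \<Rightarrow> 'x set \<Rightarrow> 'x set \<Rightarrow> 'x set \<Rightarrow>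
       ('x \<times> 'x \<times> 'x) set \<Rightarrow> ('x \<times> 'x \<times> 'x) set \<Rightarrow> bool" where
  "homogeneous_bitrade k A1 A2 A3 T T' \<longleftrightarrow>
     latin_bitrade A1 A2 A3 T T' \<and> homogeneous_trade k A1 A2 A3 T"

end

theory Submission
  imports Defs
begin

text \<open>
  Left multiplication makes \<open>g \<mapsto> (gA, gB, gC)\<close> a parametrisation of \<open>T\<close> by \<open>G\<close>, and since \<open>A\<close>,
  \<open>B\<close>, \<open>C\<close> meet trivially, any two of the three cosets determine \<open>g\<close>. Because
  \<open>a\<^sup>-\<^sup>1C = bC\<close>, the third coordinate of \<open>T'\<close> is that of \<open>T\<close> after the shift \<open>g \<mapsto> ga\<^sup>-\<^sup>1\<close>,
  which fixes the row \<open>gA\<close>, and also after the shift \<open>g \<mapsto> gb\<close>, which fixes the column \<open>gB\<close>;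
  this gives the bitrade conditions. The triples of \<open>T\<close> lying in the row \<open>gA\<close> are parametrised
  by the elements of \<open>gA\<close>, so a row has \<open>|A|\<close> entries, and likewise for columns and symbols.
\<close>

section \<open>Bitrades parametrised by three coordinate functions on an index set\<close>

lemma two_coords_determine:
  fixes u v w :: "'i \<Rightarrow> 'x"
  assumes uv: "inj_on (\<lambda>g. (u g, v g)) X" and uw: "inj_on (\<lambda>g. (u g, w g)) X"
    and vw: "inj_on (\<lambda>g. (v g, w g)) X"
    and "x \<in> (\<lambda>g. (u g, v g, w g)) ` X" "y \<in> (\<lambda>g. (u g, v g, w g)) ` X"
    and "r \<in> {1, 2, 3}" "s \<in> {1, 2, 3}" "r \<noteq> s"
    and "coord x r = coord y r" "coord x s = coord y s"
  shows "x = y"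
proof -
  obtain g h where g: "g \<in> X" "x = (u g, v g, w g)" and h: "h \<in> X" "y = (u h, v h, w h)"
    using assms(4,5) by blast
  \<comment> \<open>Up to order, two distinct positions form one of three pairs, and each pair has
    its own injectivity assumption.\<close>
  have "u g = u h \<and> v g = v h \<or> u g = u h \<and> w g = w h \<or> v g = v h \<and> w g = w h"
    using assms(6-) g h by (auto simp: coord_def)
  then have "g = h"
    using inj_onD[OF uv, of g h] inj_onD[OF uw, of g h] inj_onD[OF vw, of g h] g h by auto
  then show ?thesis using g h by simp
qed

text \<open>Uniqueness is free by \<open>two_coords_determine\<close>, so each instance of (R2) and
  (R3) reduces to naming one index \<open>i\<close>.\<close>

lemma two_coords_ex1:
  fixes u v w :: "'i \<Rightarrow> 'x"
  assumes inj: "inj_on (\<lambda>g. (u g, v g)) X" "inj_on (\<lambda>g. (u g, w g)) X"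
      "inj_on (\<lambda>g. (v g, w g)) X"
    and rs: "r \<in> {1, 2, 3}" "s \<in> {1, 2, 3}" "r \<noteq> s"
    and ex: "\<exists>i\<in>X. coord x r = coord (u i, v i, w i) r \<and> coord x s = coord (u i, v i, w i) s"
  shows "\<exists>!y. y \<in> (\<lambda>g. (u g, v g, w g)) ` X \<and> coord x r = coord y r \<and> coord x s = coord y s"
proof -
  obtain i where i: "i \<in> X" "coord x r = coord (u i, v i, w i) r"
      "coord x s = coord (u i, v i, w i) s"
    using ex by blast
  have y: "(u i, v i, w i) \<in> (\<lambda>g. (u g, v g, w g)) ` X" using i(1) by (rule imageI)
  show ?thesis
  proof (rule ex1I)
    show "(u i, v i, w i) \<in> (\<lambda>g. (u g, v g, w g)) ` X \<and>
        coord x r = coord (u i, v i, w i) r \<and> coord x s = coord (u i, v i, w i) s"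
      by (intro conjI y i(2,3))
  next
    fix z assume z: "z \<in> (\<lambda>g. (u g, v g, w g)) ` X \<and> coord x r = coord z r \<and> coord x s = coord z s"
    show "z = (u i, v i, w i)"
      by (rule two_coords_determine[OF inj conjunct1[OF z] y rs]) (simp_all only: z flip: i(2,3))
  qed
qed

lemma partial_latin_square_image:
  fixes u v w :: "'i \<Rightarrow> 'x"
  assumes "finite X" "X \<noteq> {}"
    and "inj_on (\<lambda>g. (u g, v g)) X" "inj_on (\<lambda>g. (u g, w g)) X" "inj_on (\<lambda>g. (v g, w g)) X"
    and "u ` X \<inter> v ` X = {}" "u ` X \<inter> w ` X = {}" "v ` X \<inter> w ` X = {}"
  shows "partial_latin_square (u ` X) (v ` X) (w ` X) ((\<lambda>g. (u g, v g, w g)) ` X)"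
    (is "partial_latin_square _ _ _ ?T")
proof -
  have "(\<forall>r\<in>{1, 2, 3}. \<forall>s\<in>{1, 2, 3}.
            coord x r = coord y r \<and> coord x s = coord y s \<longrightarrow> r = s) \<or>
        (\<forall>r\<in>{1, 2, 3}. coord x r = coord y r)" if "x \<in> ?T" "y \<in> ?T" for x y
    \<comment> \<open>If the first alternative of (P1) fails, two distinct positions agree, which
      forces \<open>x = y\<close> and hence the second alternative.\<close>
    using two_coords_determine[OF assms(3-5) that] by blast
  moreover have "\<exists>t\<in>?T. \<exists>r\<in>{1, 2, 3}. coord t r = \<alpha>" if "\<alpha> \<in> u ` X \<union> v ` X \<union> w ` X" for \<alpha>
    using that by (auto simp: coord_def)
  ultimately show ?thesis
    using assms unfolding partial_latin_square_def
    by (intro conjI ballI) (assumption | simp | rule image_subsetI)+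
qed

text \<open>Any two coordinates of the triple of \<open>T'\<close> at \<open>g\<close> are the same
  two coordinates of a triple of \<open>T\<close>: the one at \<open>g\<close> for (1,2), at
  \<open>p g\<close> for (1,3), and at \<open>q g\<close> for (2,3). As \<open>p\<close> and
  \<open>q\<close> are permutations of \<open>X\<close>, this correspondence can be read in both
  directions.\<close>

lemma latin_bitrade_image:
  fixes u v w :: "'i \<Rightarrow> 'x" and p q :: "'i \<Rightarrow> 'i"
  assumes X: "finite X" "X \<noteq> {}"
    and uv: "inj_on (\<lambda>g. (u g, v g)) X" and uw: "inj_on (\<lambda>g. (u g, w g)) X"
    and vw: "inj_on (\<lambda>g. (v g, w g)) X"
    and disj: "u ` X \<inter> v ` X = {}" "u ` X \<inter> w ` X = {}" "v ` X \<inter> w ` X = {}"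
    and p: "bij_betw p X X" and q: "bij_betw q X X"
    and up: "\<And>g. g \<in> X \<Longrightarrow> u (p g) = u g" and vq: "\<And>g. g \<in> X \<Longrightarrow> v (q g) = v g"
    and wpq: "\<And>g. g \<in> X \<Longrightarrow> w (q g) = w (p g)"
    and moved: "\<And>g. g \<in> X \<Longrightarrow> w (p g) \<noteq> w g"
  shows "latin_bitrade (u ` X) (v ` X) (w ` X)
           ((\<lambda>g. (u g, v g, w g)) ` X) ((\<lambda>g. (u g, v g, w (p g))) ` X)"
    (is "latin_bitrade _ _ _ ?T ?T'")
proof -
  have pX: "p g \<in> X" and qX: "q g \<in> X" if "g \<in> X" for g
    using p q that by (auto dest: bij_betwE)
  have pinv: "\<exists>h\<in>X. g = p h" and qinv: "\<exists>h\<in>X. g = q h" if "g \<in> X" for g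
    using p q that by (auto simp: bij_betw_def)
  \<comment> \<open>Since \<open>u (p g) = u g\<close>, this is the pair map \<open>(u, w)\<close>
    precomposed with the injection \<open>p\<close>; for \<open>vw'\<close> the same works with
    \<open>(v, w)\<close> and \<open>q\<close>.\<close>
  have uw': "inj_on (\<lambda>g. (u g, w (p g))) X"
  proof (rule inj_onI)
    fix g h assume "g \<in> X" "h \<in> X" "(u g, w (p g)) = (u h, w (p h))"
    then have "p g = p h" using inj_onD[OF uw, of "p g" "p h"] up pX by simp
    then show "g = h" using p \<open>g \<in> X\<close> \<open>h \<in> X\<close> by (auto simp: bij_betw_def dest: inj_onD)
  qed
  have vw': "inj_on (\<lambda>g. (v g, w (p g))) X"
  proof (rule inj_onI)
    fix g h assume "g \<in> X" "h \<in> X" "(v g, w (p g)) = (v h, w (p h))"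
    then have "q g = q h" using inj_onD[OF vw, of "q g" "q h"] vq wpq qX by simp
    then show "g = h" using q \<open>g \<in> X\<close> \<open>h \<in> X\<close> by (auto simp: bij_betw_def dest: inj_onD)
  qed
  have wp: "(\<lambda>g. w (p g)) ` X = w ` X"
    using p by (metis bij_betw_imp_surj_on image_image)
  have "partial_latin_square (u ` X) (v ` X) (w ` X) ?T"
    using X uv uw vw disj by (rule partial_latin_square_image)
  moreover have "partial_latin_square (u ` X) (v ` X) (w ` X) ?T'"
    using partial_latin_square_image[OF X uv uw' vw'] disj unfolding wp by blast
  \<comment> \<open>In a common triple the first two coordinates force both indices to be the same
    \<open>g\<close>, and then \<open>w (p g) = w g\<close>, contrary to
    \<open>moved\<close>.\<close>
  moreover have "?T \<inter> ?T' = {}"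
    using inj_onD[OF uv] moved by force
  moreover have "\<exists>!y. y \<in> ?T' \<and> coord x r = coord y r \<and> coord x s = coord y s"
    if x: "x \<in> ?T" and rs: "r \<in> {1, 2, 3}" "s \<in> {1, 2, 3}" "r \<noteq> s" for x r s
  proof -
    obtain g where g: "g \<in> X" "x = (u g, v g, w g)" using x by blast
    obtain h k where h: "h \<in> X" "g = p h" and k: "k \<in> X" "g = q k"
      using pinv qinv g by blast
    \<comment> \<open>The witnesses are \<open>g\<close> itself, its preimage \<open>h\<close> under
      \<open>p\<close>, and its preimage \<open>k\<close> under \<open>q\<close>.\<close>
    have "\<exists>i\<in>X. u g = u i \<and> v g = v i" "\<exists>i\<in>X. u g = u i \<and> w g = w (p i)"
      "\<exists>i\<in>X. v g = v i \<and> w g = w (p i)"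
      using g(1) h k up[OF h(1)] vq[OF k(1)] wpq[OF k(1)] by metis+
    then have "\<exists>i\<in>X. coord x r = coord (u i, v i, w (p i)) r \<and>
        coord x s = coord (u i, v i, w (p i)) s"
      using rs unfolding g(2) by (elim insertE emptyE) (simp_all add: coord_def conj_commute)
    then show ?thesis by (rule two_coords_ex1[OF uv uw' vw' rs])
  qed
  moreover have "\<exists>!y. y \<in> ?T \<and> coord x r = coord y r \<and> coord x s = coord y s"
    if x: "x \<in> ?T'" and rs: "r \<in> {1, 2, 3}" "s \<in> {1, 2, 3}" "r \<noteq> s" for x r s
  proof -
    obtain g where g: "g \<in> X" "x = (u g, v g, w (p g))" using x by blast
    \<comment> \<open>In this direction the witnesses are \<open>g\<close>, \<open>p g\<close> and
      \<open>q g\<close>.\<close>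
    have "\<exists>i\<in>X. u g = u i \<and> v g = v i" "\<exists>i\<in>X. u g = u i \<and> w (p g) = w i"
      "\<exists>i\<in>X. v g = v i \<and> w (p g) = w i"
      using g(1) pX qX up vq wpq by metis+
    then have "\<exists>i\<in>X. coord x r = coord (u i, v i, w i) r \<and> coord x s = coord (u i, v i, w i) s"
      using rs unfolding g(2) by (elim insertE emptyE) (simp_all add: coord_def conj_commute)
    then show ?thesis by (rule two_coords_ex1[OF uv uw vw rs])
  qed
  ultimately show ?thesis
    unfolding latin_bitrade_def
    by (intro conjI ballI impI) assumption+
qed

section \<open>Left cosets of subgroups that meet trivially\<close>

context group
begin

lemma lcoset_eq_iff:
  assumes "subgroup H G" "g \<in> carrier G" "h \<in> carrier G"
  shows "g <# H = h <# H \<longleftrightarrow> h \<in> g <# H"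
  using l_repr_independence[OF _ assms(2,1), of h] lcos_self[OF assms(3,1)] by auto

lemma lcosets_eq_image: "lcosets H = (\<lambda>g. g <# H) ` carrier G"
  by (auto simp: LCOSETS_def)

lemma lcoset_m_mem:
  assumes "subgroup H G" "g \<in> carrier G" "h \<in> H"
  shows "(g \<otimes> h) <# H = g <# H"
proof -
  have "g \<otimes> h \<in> g <# H" using assms(3) by (auto simp: l_coset_def)
  then show ?thesis using l_repr_independence assms by metis
qed

text \<open>The cosets \<open>g <# H\<close> and \<open>g <# K\<close> meet in
  \<open>g <# (H \<inter> K)\<close>, which is just \<open>g\<close>.\<close>

lemma lcoset_pair_inj:
  assumes H: "subgroup H G" and K: "subgroup K G" and HK: "H \<inter> K = {\<one>}"
  shows "inj_on (\<lambda>g. (g <# H, g <# K)) (carrier G)"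
proof (rule inj_onI)
  fix g h assume gh: "g \<in> carrier G" "h \<in> carrier G" "(g <# H, g <# K) = (h <# H, h <# K)"
  then have "h \<in> g <# H" "h \<in> g <# K" using lcoset_eq_iff H K by auto
  then obtain x y where xy: "x \<in> H" "y \<in> K" "h = g \<otimes> x" "h = g \<otimes> y"
    by (auto simp: l_coset_def)
  then have "x = y"
    using gh(1) Units_l_cancel[of g x y] subgroup.mem_carrier[OF H] subgroup.mem_carrier[OF K]
    by simp
  then have "y = \<one>" using xy HK by blast
  then show "g = h" using xy(4) gh(1) by simp
qed

text \<open>A common coset can be written with the same representative for both subgroups;
  cancelling it gives \<open>H \<subseteq> K\<close>, so \<open>H = H \<inter> K\<close> would be
  trivial.\<close>

lemma lcosets_disjoint:
  assumes H: "subgroup H G" and K: "subgroup K G" and HK: "H \<inter> K = {\<one>}" and "H \<noteq> {\<one>}"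
  shows "lcosets H \<inter> lcosets K = {}"
proof (rule ccontr)
  assume "lcosets H \<inter> lcosets K \<noteq> {}"
  then obtain g h where g: "g \<in> carrier G" and h: "h \<in> carrier G" and eq: "g <# H = h <# K"
    by (auto simp: LCOSETS_def)
  have "g <# K = h <# K"
    using lcoset_eq_iff[OF K h g] lcos_self[OF g H] eq by simp
  with eq have same: "g <# H = g <# K" by simp
  have "x \<in> K" if "x \<in> H" for x
  proof -
    have "g \<otimes> x \<in> g <# K" using that same by (auto simp: l_coset_def)
    then show ?thesis
      using that g Units_l_cancel[of g] subgroup.mem_carrier[OF H] subgroup.mem_carrier[OF K]
      by (auto simp: l_coset_def)
  qed
  then show False using HK \<open>H \<noteq> {\<one>}\<close> by blast
qed

text \<open>The indices whose triple has \<open>g <# H\<close> at position \<open>r\<close> are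
  exactly the elements of that coset, and \<open>f\<close> counts each of them once.\<close>

lemma card_lcoset_fibre:
  assumes H: "subgroup H G" and g: "g \<in> carrier G" and f: "inj_on f (carrier G)"
    and coord: "\<And>h. h \<in> carrier G \<Longrightarrow> coord (f h) r = h <# H"
  shows "card {t \<in> f ` carrier G. coord t r = g <# H} = card H"
proof -
  have sub: "g <# H \<subseteq> carrier G" using g H by (simp add: l_coset_subset_G subgroup.subset)
  have "{t \<in> f ` carrier G. coord t r = g <# H} = f ` (g <# H)"
  proof (intro Set.set_eqI iffI)
    fix t assume "t \<in> {t \<in> f ` carrier G. coord t r = g <# H}"
    then obtain h where h: "h \<in> carrier G" "t = f h" "h <# H = g <# H" using coord by auto
    then show "t \<in> f ` (g <# H)" using lcoset_eq_iff[OF H g h(1)] by blast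
  next
    fix t assume "t \<in> f ` (g <# H)"
    then obtain h where h: "h \<in> g <# H" "t = f h" by blast
    with sub have "h \<in> carrier G" by blast
    then show "t \<in> {t \<in> f ` carrier G. coord t r = g <# H}"
      using h coord lcoset_eq_iff[OF H g, of h] by simp
  qed
  also have "card \<dots> = card (g <# H)"
    using f sub by (meson card_image inj_on_subset)
  also have "\<dots> = card H"
  proof -
    have "g <# H = (\<otimes>) g ` H" by (auto simp: l_coset_def)
    moreover have "inj_on ((\<otimes>) g) H"
      using g subgroup.mem_carrier[OF H] by (auto simp: inj_on_def)
    ultimately show ?thesis by (simp add: card_image)
  qed
  finally show ?thesis .
qed

lemma homogeneous_trade_lcosets:
  assumes H: "subgroup H G" and K: "subgroup K G" and L: "subgroup L G" and "H \<inter> K = {\<one>}"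
  shows "homogeneous_trade k (lcosets H) (lcosets K) (lcosets L)
           ((\<lambda>g. (g <# H, g <# K, g <# L)) ` carrier G)
         \<longleftrightarrow> card H = k \<and> card K = k \<and> card L = k"
proof -
  let ?f = "\<lambda>g. (g <# H, g <# K, g <# L)"
  have inj: "inj_on ?f (carrier G)"
    using lcoset_pair_inj[OF H K] assms(4) by (auto simp: inj_on_def)
  have "card {t \<in> ?f ` carrier G. coord t 1 = g <# H} = card H"
    "card {t \<in> ?f ` carrier G. coord t 2 = g <# K} = card K"
    "card {t \<in> ?f ` carrier G. coord t 3 = g <# L} = card L" if "g \<in> carrier G" for g
    by (rule card_lcoset_fibre[OF _ that inj]; use H K L in \<open>simp add: coord_def\<close>)+
  \<comment> \<open>From left to right, the coset of \<open>\<one>\<close> provides a row, a column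
    and a symbol at which the count can be evaluated.\<close>
  then show ?thesis
    unfolding homogeneous_trade_def lcosets_eq_image using one_closed by auto
qed

lemma bij_betw_right_mult:
  assumes "x \<in> carrier G"
  shows "bij_betw (\<lambda>g. g \<otimes> x) (carrier G) (carrier G)"
  by (rule bij_betw_byWitness[where f' = "\<lambda>g. g \<otimes> inv x"]) (use assms in \<open>auto simp: m_assoc\<close>)

lemma latin_bitrade_lcosets:
  assumes fin: "finite (carrier G)"
    and A: "subgroup A G" and B: "subgroup B G" and C: "subgroup C G"
    and abc: "a \<in> A" "b \<in> B" "c \<in> C" "a \<otimes> b \<otimes> c = \<one>" and ne: "a \<noteq> \<one>" "b \<noteq> \<one>"
    and AB: "A \<inter> B = {\<one>}" and AC: "A \<inter> C = {\<one>}" and BC: "B \<inter> C = {\<one>}"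
  shows "latin_bitrade (lcosets A) (lcosets B) (lcosets C)
           ((\<lambda>g. (g <# A, g <# B, g <# C)) ` carrier G)
           ((\<lambda>g. (g <# A, g <# B, (g \<otimes> inv a) <# C)) ` carrier G)"
proof -
  have carr: "a \<in> carrier G" "b \<in> carrier G" "c \<in> carrier G"
    using abc A B C by (auto dest: subgroup.mem_carrier)
  have ia: "inv a \<in> A" using abc A by (simp add: subgroup.m_inv_closed)
  have "inv a = b \<otimes> c"
    using abc(4) carr by (metis inv_equality inv_comm m_assoc m_closed)
  \<comment> \<open>Right multiplication by \<open>c\<close> does not change a coset of
    \<open>C\<close>, and \<open>b \<otimes> c\<close> is \<open>inv a\<close>.\<close>
  then have shift: "(g \<otimes> b) <# C = (g \<otimes> inv a) <# C" if "g \<in> carrier G" for g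
    using lcoset_m_mem[OF C, of "g \<otimes> b" c] that abc carr by (simp add: m_assoc)
  \<comment> \<open>An unmoved symbol would put \<open>inv a\<close> into
    \<open>A \<inter> C\<close>, making \<open>a\<close> the identity.\<close>
  have moved: "(g \<otimes> inv a) <# C \<noteq> g <# C" if g: "g \<in> carrier G" for g
  proof
    assume "(g \<otimes> inv a) <# C = g <# C"
    then have "g \<otimes> inv a \<in> g <# C"
      using lcoset_eq_iff[OF C g, of "g \<otimes> inv a"] g carr by simp
    then have "inv a \<in> C"
      using g carr subgroup.mem_carrier[OF C] by (auto simp: l_coset_def)
    then have "inv a = \<one>" using ia AC by blast
    then show False using ne carr by (metis inv_inv inv_one)
  qed
  have nt: "A \<noteq> {\<one>}" "B \<noteq> {\<one>}" using abc ne by auto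
  show ?thesis
    unfolding lcosets_eq_image
  \<comment> \<open>Here \<open>p\<close> is right multiplication by \<open>inv a\<close>, which
    preserves rows, and \<open>q\<close> is right multiplication by \<open>b\<close>, which
    preserves columns.\<close>
  proof (rule latin_bitrade_image[where q = "\<lambda>g. g \<otimes> b"])
    show "(\<lambda>g. g <# A) ` carrier G \<inter> (\<lambda>g. g <# B) ` carrier G = {}"
      using lcosets_disjoint[OF A B AB nt(1)] by (simp add: lcosets_eq_image)
    show "(\<lambda>g. g <# A) ` carrier G \<inter> (\<lambda>g. g <# C) ` carrier G = {}"
      using lcosets_disjoint[OF A C AC nt(1)] by (simp add: lcosets_eq_image)
    show "(\<lambda>g. g <# B) ` carrier G \<inter> (\<lambda>g. g <# C) ` carrier G = {}"
      using lcosets_disjoint[OF B C BC nt(2)] by (simp add: lcosets_eq_image)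
    show "inj_on (\<lambda>g. (g <# A, g <# B)) (carrier G)"
      "inj_on (\<lambda>g. (g <# A, g <# C)) (carrier G)" "inj_on (\<lambda>g. (g <# B, g <# C)) (carrier G)"
      by (intro lcoset_pair_inj A B C AB AC BC)+
    show "bij_betw (\<lambda>g. g \<otimes> inv a) (carrier G) (carrier G)"
      "bij_betw (\<lambda>g. g \<otimes> b) (carrier G) (carrier G)"
      by (intro bij_betw_right_mult inv_closed carr)+
    show "(g \<otimes> inv a) <# A = g <# A" "(g \<otimes> b) <# B = g <# B" if "g \<in> carrier G" for g
      by (rule lcoset_m_mem[OF A that ia], rule lcoset_m_mem[OF B that abc(2)])
    show "carrier G \<noteq> {}" using one_closed by blast
  qed (rule fin shift moved | assumption)+
qed

end

theorem lemma3p7: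
  fixes G :: "('g, 'm) monoid_scheme" (structure)
    and a b c :: 'g
    and A B C :: "'g set"
    and T T' :: "('g set \<times> 'g set \<times> 'g set) set"
    and k :: nat
  assumes "group G" and "finite (carrier G)"
    and "a \<in> carrier G" and "b \<in> carrier G" and "c \<in> carrier G"
    and "a \<noteq> \<one>" and "b \<noteq> \<one>" and "c \<noteq> \<one>"
    and "A = generate G {a}" and "B = generate G {b}" and "C = generate G {c}"
    and "a \<otimes> b \<otimes> c = \<one>"
    and "card (A \<inter> B) = 1" and "card (A \<inter> C) = 1" and "card (B \<inter> C) = 1"
    and "carrier G = generate G {a, b, c}"
    and "T = {(g <# A, g <# B, g <# C) | g. g \<in> carrier G}"
    and "T' = {(g <# A, g <# B, (g \<otimes> inv a) <# C) | g. g \<in> carrier G}"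
  shows "homogeneous_bitrade k (lcosets A) (lcosets B) (lcosets C) T T'
           \<longleftrightarrow> card A = card B \<and> card B = card C \<and> card C = k"
proof -
  interpret group G by fact
  have sub: "subgroup A G" "subgroup B G" "subgroup C G"
    using assms(3-5,9-11) by (auto intro: generate_is_subgroup)
  \<comment> \<open>The single common element must be \<open>\<one>\<close>, which lies in every
    subgroup.\<close>
  have trivial: "H \<inter> K = {\<one>}" if "card (H \<inter> K) = 1" "subgroup H G" "subgroup K G" for H K
    using that by (metis IntI card_1_singletonE singletonD subgroup.one_closed)
  have int: "A \<inter> B = {\<one>}" "A \<inter> C = {\<one>}" "B \<inter> C = {\<one>}"
    using trivial sub assms(13-15) by blast+
  have mem: "a \<in> A" "b \<in> B" "c \<in> C"
    using assms(9-11) by (auto intro: generate.incl)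
  have T: "T = (\<lambda>g. (g <# A, g <# B, g <# C)) ` carrier G"
    "T' = (\<lambda>g. (g <# A, g <# B, (g \<otimes> inv a) <# C)) ` carrier G"
    using assms(17,18) by auto
  have "latin_bitrade (lcosets A) (lcosets B) (lcosets C) T T'"
    unfolding T using assms(2) sub mem assms(12,6,7) int by (rule latin_bitrade_lcosets)
  moreover have "homogeneous_trade k (lcosets A) (lcosets B) (lcosets C) T
      \<longleftrightarrow> card A = k \<and> card B = k \<and> card C = k"
    unfolding T using sub int(1) by (rule homogeneous_trade_lcosets)
  \<comment> \<open>The bitrade condition always holds, so the equivalence rests on the count in
    \<open>T\<close> alone.\<close>
  ultimately show ?thesis
    unfolding homogeneous_bitrade_def by auto
qed

end
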